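(* In the setting below, let $\gamma$ be a proper and invertible generalizer. If $\mathrm{GCG}_{\simeq}(\Phi,\psi,\gamma)$ maintains Property 3 (for the generalizer $\gamma$) as an invariant, then it also maintains Property 4 as an invariant.
   Context: LTS setting. A labeled transition system (LTS) is $\langle\Sigma,Q,Q_0,\Delta\rangle$ (finite labels $\Sigma$, finite states $Q$, initial states $Q_0\subseteq Q$, $\Delta\subseteq Q\times\Sigma\times Q$). Fix an LTS $M_0=\langle\Sigma,Q,Q_0,\Delta_0\rangle$; a completion of $M_0$ is an LTS with the same $\Sigma,Q,Q_0$ and a transition relation $\Delta\supseteq\Delta_0$. Let $V=\{x_{p,a,q}: p,q\in Q, a\in\Sigma\}$; an assignment $\sigma:V\to\{0,1\}$ encodes the LTS $M_\sigma$ with $\Sigma,Q,Q_0$ and $\Delta_\sigma=\{(p,a,q):\sigma(x_{p,a,q})=1\}$. $\Phi$ is a propositional formula over $V$ that implies $\bigwedge_{(p,a,q)\in\Delta_0}x_{p,a,q}$. Let $A$ be the set of non-initial states of $M_0$ with no incoming or outgoing transitions in $\Delta_0$. For assignments $\sigma,\rho$ satisfying $\Phi$, $\sigma\simeq\rho$ means there is a bijection $f:Q\to Q$ with $f(q)=q$ for $q\notin A$ such that $(p,a,q)\in\Delta_\sigma$ iff $(f(p),a,f(q))\in\Delta_\rho$. For $\rho\models\Phi$, $[\rho]=\{\sigma:\sigma\models\Phi,\ \sigma\simeq\rho\}$, also viewed as the formula satisfied exactly by its elements. $\psi$ is a specification with satisfaction relation $M\models\psi$, assumed invariant under isomorphism: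 if $\sigma\simeq\rho$ then $M_\sigma\models\psi$ iff $M_\rho\models\psi$. An assignment is identified with the formula satisfied by exactly it. A generalizer maps assignments to formulas over $V$; $\gamma$ is proper if for every $\sigma\models\Phi$ with $M_\sigma\not\models\psi$: $\sigma\models\gamma(\sigma)$, and no $\rho$ with $\rho\models\Phi$, $M_\rho\models\psi$ satisfies $\gamma(\sigma)$. For an assignment $\tau$, $\gamma^{-1}(\tau)$ is the formula satisfied exactly by those $\sigma$ with $\tau\models\gamma(\sigma)$. A formula $\varphi$ subsumes $\varphi'$ up to isomorphism if for every $\sigma\models\varphi$ there is $\sigma'\models\varphi'$ with $\sigma'\simeq\sigma$; they are equivalent up to isomorphism if each subsumes the other. $\gamma$ is invertible if for all $\tau,\tau'$ satisfying $\Phi$ with $\tau\simeq\tau'$, $\gamma^{-1}(\tau)$ and $\gamma^{-1}(\tau')$ are equivalent up to isomorphism. Algorithm $\mathrm{GCG}_{\simeq}(\Phi,\psi,g)$ for a generalizer $g$: keep $\Phi_{cur}:=\Phi$; while $\Phi_{cur}$ is satisfiable, pick an arbitrary $\sigma\models\Phi_{cur}$; if $M_\sigma\models\psi$, output $\sigma$ (a solution) and set $\Phi_{cur}:=\Phi_{cur}\wedge\neg[\sigma]$; else set $\Phi_{cur}:=\Phi_{cur}\wedge\neg g(\sigma)$. In an execution, $\mathsf{Sol}$ is the set of solutions output so far and $\mathsf{Pruned}$ is the set of all assignments satisfying some formula $\varphi$ for which a step $\Phi_{cur}:=\Phi_{cur}\wedge\neg\varphi$ has been performed so far. Property 3 (invariant,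 for generalizer $g$): in every execution, at every point, for every $\sigma$ for which the step $\Phi_{cur}:=\Phi_{cur}\wedge\neg g(\sigma)$ has been performed so far and every $\rho\simeq\sigma$, every assignment satisfying $g(\rho)$ belongs to $\mathsf{Pruned}$. Property 4 (invariant): in every execution, at every point, for all $\tau,\tau'$ satisfying $\Phi$ with $\tau\in\mathsf{Pruned}$ and $\tau'\simeq\tau$, we have $\tau'\in\mathsf{Pruned}$ or $\tau'\in\mathsf{Sol}$. *)

theory Defs
  imports Main "HOL-Library.FuncSet"
begin

record ('q, 's) lts =
  labels :: "'s set"
  states :: "'q set"
  initial :: "'q set"
  transitions :: "('q \<times> 's \<times> 'q) set"

definition wf_lts :: "('q, 's) lts \<Rightarrow> bool" where
  "wf_lts M \<longleftrightarrow> finite (labels M) \<and> finite (states M) \<and> initial M \<subseteq> states M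
     \<and> transitions M \<subseteq> states M \<times> labels M \<times> states M"

text \<open>The propositional variable $x_{p,a,q}$ is represented by the triple $(p,a,q)$ itself.\<close>

type_synonym ('q, 's) var = "'q \<times> 's \<times> 'q"
type_synonym ('q, 's) asg = "('q, 's) var \<Rightarrow> bool"

definition lts_vars :: "('q, 's) lts \<Rightarrow> ('q, 's) var set" where
  "lts_vars M = states M \<times> labels M \<times> states M"

text \<open>Assignments are extensional functions, so that two assignments are equal iff they agree
  on the variables.\<close>

definition assignments :: "('q, 's) lts \<Rightarrow> ('q, 's) asg set" where
  "assignments M = lts_vars M \<rightarrow>\<^sub>E UNIV"

definition lts_of :: "('q, 's) lts \<Rightarrow> ('q, 's) asg \<Rightarrow> ('q, 's) lts" where
  "lts_of M0 \<sigma> = M0\<lparr>transitions := {v \<in> lts_vars M0. \<sigma> v}\<rparr>"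

datatype (atoms: 'v) form =
    FBot
  | FAtom 'v
  | FNeg "'v form"
  | FAnd "'v form" "'v form"

primrec sat :: "('v \<Rightarrow> bool) \<Rightarrow> 'v form \<Rightarrow> bool" where
  "sat \<sigma> FBot \<longleftrightarrow> False"
| "sat \<sigma> (FAtom v) \<longleftrightarrow> \<sigma> v"
| "sat \<sigma> (FNeg \<phi>) \<longleftrightarrow> \<not> sat \<sigma> \<phi>"
| "sat \<sigma> (FAnd \<phi> \<chi>) \<longleftrightarrow> sat \<sigma> \<phi> \<and> sat \<sigma> \<chi>"

definition formulas :: "('q, 's) lts \<Rightarrow> ('q, 's) var form set" where
  "formulas M0 = {\<phi>. atoms \<phi> \<subseteq> lts_vars M0}"

definition models :: "('q, 's) lts \<Rightarrow> ('q, 's) var form \<Rightarrow> ('q, 's) asg set" where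
  "models M0 \<phi> = {\<sigma> \<in> assignments M0. sat \<sigma> \<phi>}"

text \<open>A formula satisfied by exactly the assignments in \<open>S\<close>. It exists since there are only
  finitely many variables (\<open>models_formula_of\<close> below) and is unique up to equivalence.\<close>

definition formula_of :: "('q, 's) lts \<Rightarrow> ('q, 's) asg set \<Rightarrow> ('q, 's) var form" where
  "formula_of M0 S = (SOME \<phi>. \<phi> \<in> formulas M0 \<and> models M0 \<phi> = S)"

lemma formula_for_singleton:
  assumes "finite W"
  shows "\<exists>\<phi>. atoms \<phi> \<subseteq> W \<and> (\<forall>\<rho>. sat \<rho> \<phi> \<longleftrightarrow> (\<forall>v\<in>W. \<rho> v = \<sigma> v))"
  using assms
proof (induction W rule: finite_induct)
  case empty
  show ?case by (rule exI[of _ "FNeg FBot"]) simp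
next
  case (insert w W)
  then obtain \<phi> where \<phi>: "atoms \<phi> \<subseteq> W" "\<forall>\<rho>. sat \<rho> \<phi> \<longleftrightarrow> (\<forall>v\<in>W. \<rho> v = \<sigma> v)"
    by blast
  show ?case
    by (rule exI[of _ "FAnd (if \<sigma> w then FAtom w else FNeg (FAtom w)) \<phi>"]) (use \<phi> in auto)
qed

lemma ex_formula_of:
  assumes "wf_lts M0" "S \<subseteq> assignments M0"
  shows "\<exists>\<phi>. \<phi> \<in> formulas M0 \<and> models M0 \<phi> = S"
proof -
  have fin: "finite (lts_vars M0)"
    using assms(1) by (simp add: wf_lts_def lts_vars_def)
  then have "finite (assignments M0)"
    unfolding assignments_def by (intro finite_PiE) auto
  then have "finite S"
    using assms(2) finite_subset by blast
  then show ?thesis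
    using assms(2)
  proof (induction S rule: finite_induct)
    case empty
    show ?case by (rule exI[of _ FBot]) (simp add: formulas_def models_def)
  next
    case (insert \<sigma> S)
    then obtain \<phi> where \<phi>: "\<phi> \<in> formulas M0" "models M0 \<phi> = S"
      by auto
    obtain \<chi> where \<chi>: "atoms \<chi> \<subseteq> lts_vars M0"
        "\<forall>\<rho>. sat \<rho> \<chi> \<longleftrightarrow> (\<forall>v\<in>lts_vars M0. \<rho> v = \<sigma> v)"
      using formula_for_singleton[OF fin, of \<sigma>] by blast
    have "\<rho> = \<sigma>" if "\<rho> \<in> assignments M0" "sat \<rho> \<chi>" for \<rho>
      using that insert.prems \<chi>(2) unfolding assignments_def
      by (intro PiE_ext[of \<rho> "lts_vars M0" _ \<sigma>]) auto
    then have "models M0 \<chi> = {\<sigma>}"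
      using \<chi>(2) insert.prems by (auto simp: models_def)
    then have "models M0 (FNeg (FAnd (FNeg \<chi>) (FNeg \<phi>))) = insert \<sigma> S"
      using \<phi>(2) by (auto simp: models_def)
    moreover have "FNeg (FAnd (FNeg \<chi>) (FNeg \<phi>)) \<in> formulas M0"
      using \<phi>(1) \<chi>(1) by (simp add: formulas_def)
    ultimately show ?case by blast
  qed
qed

lemma models_formula_of:
  assumes "wf_lts M0" "S \<subseteq> assignments M0"
  shows "formula_of M0 S \<in> formulas M0" "models M0 (formula_of M0 S) = S"
  using someI_ex[OF ex_formula_of[OF assms]] by (simp_all add: formula_of_def)

definition isolated_states :: "('q, 's) lts \<Rightarrow> 'q set" where
  "isolated_states M0 = {q \<in> states M0. q \<notin> initial M0
     \<and> (\<forall>p a. (p, a, q) \<notin> transitions M0 \<and> (q, a, p) \<notin> transitions M0)}"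

text \<open>Isomorphism is a relation between assignments that satisfy \<open>\<Phi>\<close>; both memberships are
  part of the relation.\<close>

definition iso ::
  "('q, 's) lts \<Rightarrow> ('q, 's) var form \<Rightarrow> ('q, 's) asg \<Rightarrow> ('q, 's) asg \<Rightarrow> bool" where
  "iso M0 \<Phi> \<sigma> \<rho> \<longleftrightarrow> \<sigma> \<in> models M0 \<Phi> \<and> \<rho> \<in> models M0 \<Phi> \<and>
     (\<exists>f. bij_betw f (states M0) (states M0)
        \<and> (\<forall>q \<in> states M0 - isolated_states M0. f q = q)
        \<and> (\<forall>p \<in> states M0. \<forall>a \<in> labels M0. \<forall>q \<in> states M0.
             (p, a, q) \<in> transitions (lts_of M0 \<sigma>)
               \<longleftrightarrow> (f p, a, f q) \<in> transitions (lts_of M0 \<rho>)))"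

definition iso_class ::
  "('q, 's) lts \<Rightarrow> ('q, 's) var form \<Rightarrow> ('q, 's) asg \<Rightarrow> ('q, 's) asg set" where
  "iso_class M0 \<Phi> \<rho> = {\<sigma> \<in> models M0 \<Phi>. iso M0 \<Phi> \<sigma> \<rho>}"

text \<open>A specification is represented by its satisfaction predicate on LTSs.\<close>

type_synonym ('q, 's) spec = "('q, 's) lts \<Rightarrow> bool"

definition iso_invariant ::
  "('q, 's) lts \<Rightarrow> ('q, 's) var form \<Rightarrow> ('q, 's) spec \<Rightarrow> bool" where
  "iso_invariant M0 \<Phi> \<psi> \<longleftrightarrow>
     (\<forall>\<sigma> \<rho>. iso M0 \<Phi> \<sigma> \<rho> \<longrightarrow> (\<psi> (lts_of M0 \<sigma>) \<longleftrightarrow> \<psi> (lts_of M0 \<rho>)))"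

type_synonym ('q, 's) gen = "('q, 's) asg \<Rightarrow> ('q, 's) var form"

definition generalizer :: "('q, 's) lts \<Rightarrow> ('q, 's) gen \<Rightarrow> bool" where
  "generalizer M0 g \<longleftrightarrow> (\<forall>\<sigma> \<in> assignments M0. g \<sigma> \<in> formulas M0)"

definition proper ::
  "('q, 's) lts \<Rightarrow> ('q, 's) var form \<Rightarrow> ('q, 's) spec \<Rightarrow> ('q, 's) gen \<Rightarrow> bool" where
  "proper M0 \<Phi> \<psi> g \<longleftrightarrow>
     (\<forall>\<sigma> \<in> models M0 \<Phi>. \<not> \<psi> (lts_of M0 \<sigma>) \<longrightarrow>
        sat \<sigma> (g \<sigma>) \<and> \<not> (\<exists>\<rho> \<in> models M0 \<Phi>. \<psi> (lts_of M0 \<rho>) \<and> sat \<rho> (g \<sigma>)))"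

definition gen_inverse ::
  "('q, 's) lts \<Rightarrow> ('q, 's) gen \<Rightarrow> ('q, 's) asg \<Rightarrow> ('q, 's) var form" where
  "gen_inverse M0 g \<tau> = formula_of M0 {\<sigma> \<in> assignments M0. sat \<tau> (g \<sigma>)}"

text \<open>As isomorphism is only meaningful between assignments satisfying \<open>\<Phi>\<close>, subsumption only
  asks for a counterpart of those \<open>\<sigma>\<close>. Without the restriction, a formula with a model
  outside \<open>\<Phi>\<close> would not even subsume itself.\<close>

definition subsumes_iso ::
  "('q, 's) lts \<Rightarrow> ('q, 's) var form \<Rightarrow> ('q, 's) var form \<Rightarrow> ('q, 's) var form \<Rightarrow> bool" where
  "subsumes_iso M0 \<Phi> \<phi> \<phi>' \<longleftrightarrow>
     (\<forall>\<sigma> \<in> models M0 \<Phi>. sat \<sigma> \<phi> \<longrightarrow> (\<exists>\<sigma>' \<in> models M0 \<phi>'. iso M0 \<Phi> \<sigma>' \<sigma>))"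

definition equiv_iso ::
  "('q, 's) lts \<Rightarrow> ('q, 's) var form \<Rightarrow> ('q, 's) var form \<Rightarrow> ('q, 's) var form \<Rightarrow> bool" where
  "equiv_iso M0 \<Phi> \<phi> \<phi>' \<longleftrightarrow> subsumes_iso M0 \<Phi> \<phi> \<phi>' \<and> subsumes_iso M0 \<Phi> \<phi>' \<phi>"

definition invertible ::
  "('q, 's) lts \<Rightarrow> ('q, 's) var form \<Rightarrow> ('q, 's) gen \<Rightarrow> bool" where
  "invertible M0 \<Phi> g \<longleftrightarrow>
     (\<forall>\<tau> \<in> models M0 \<Phi>. \<forall>\<tau>' \<in> models M0 \<Phi>. iso M0 \<Phi> \<tau> \<tau>' \<longrightarrow>
        equiv_iso M0 \<Phi> (gen_inverse M0 g \<tau>) (gen_inverse M0 g \<tau>'))"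

text \<open>A configuration of the algorithm records, besides the current formula and the solutions
  output so far, the history needed to state the invariants: \<open>excluded\<close> holds the formulas
  whose negation has been conjoined so far, and \<open>generalized\<close> the assignments \<open>\<sigma>\<close> for which
  the negation of \<open>g \<sigma>\<close> has been conjoined. One step is one iteration of the loop.\<close>

record ('q, 's) config =
  cur :: "('q, 's) var form"
  sol :: "('q, 's) asg set"
  excluded :: "('q, 's) var form set"
  generalized :: "('q, 's) asg set"

definition gcg_start :: "('q, 's) var form \<Rightarrow> ('q, 's) config" where
  "gcg_start \<Phi> = \<lparr>cur = \<Phi>, sol = {}, excluded = {}, generalized = {}\<rparr>"

inductive gcg_step ::
  "('q, 's) lts \<Rightarrow> ('q, 's) var form \<Rightarrow> ('q, 's) spec \<Rightarrow> ('q, 's) gen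
     \<Rightarrow> ('q, 's) config \<Rightarrow> ('q, 's) config \<Rightarrow> bool"
  for M0 \<Phi> \<psi> g where
  solution:
    "\<lbrakk>\<sigma> \<in> models M0 (cur c); \<psi> (lts_of M0 \<sigma>); \<phi> = formula_of M0 (iso_class M0 \<Phi> \<sigma>)\<rbrakk>
     \<Longrightarrow> gcg_step M0 \<Phi> \<psi> g c
           (c\<lparr>cur := FAnd (cur c) (FNeg \<phi>),
              sol := insert \<sigma> (sol c),
              excluded := insert \<phi> (excluded c)\<rparr>)"
| generalize:
    "\<lbrakk>\<sigma> \<in> models M0 (cur c); \<not> \<psi> (lts_of M0 \<sigma>)\<rbrakk>
     \<Longrightarrow> gcg_step M0 \<Phi> \<psi> g c
           (c\<lparr>cur := FAnd (cur c) (FNeg (g \<sigma>)),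
              excluded := insert (g \<sigma>) (excluded c),
              generalized := insert \<sigma> (generalized c)\<rparr>)"

definition pruned :: "('q, 's) lts \<Rightarrow> ('q, 's) config \<Rightarrow> ('q, 's) asg set" where
  "pruned M0 c = (\<Union>\<phi> \<in> excluded c. models M0 \<phi>)"

definition gcg_maintains ::
  "('q, 's) lts \<Rightarrow> ('q, 's) var form \<Rightarrow> ('q, 's) spec \<Rightarrow> ('q, 's) gen
     \<Rightarrow> (('q, 's) config \<Rightarrow> bool) \<Rightarrow> bool" where
  "gcg_maintains M0 \<Phi> \<psi> g I \<longleftrightarrow>
     (\<forall>c. (gcg_step M0 \<Phi> \<psi> g)\<^sup>*\<^sup>* (gcg_start \<Phi>) c \<longrightarrow> I c)"

definition property3 ::
  "('q, 's) lts \<Rightarrow> ('q, 's) var form \<Rightarrow> ('q, 's) gen \<Rightarrow> ('q, 's) config \<Rightarrow> bool" where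
  "property3 M0 \<Phi> g c \<longleftrightarrow>
     (\<forall>\<sigma> \<in> generalized c. \<forall>\<rho>. iso M0 \<Phi> \<rho> \<sigma> \<longrightarrow> models M0 (g \<rho>) \<subseteq> pruned M0 c)"

definition property4 ::
  "('q, 's) lts \<Rightarrow> ('q, 's) var form \<Rightarrow> ('q, 's) config \<Rightarrow> bool" where
  "property4 M0 \<Phi> c \<longleftrightarrow>
     (\<forall>\<tau> \<in> models M0 \<Phi>. \<forall>\<tau>' \<in> models M0 \<Phi>.
        \<tau> \<in> pruned M0 c \<and> iso M0 \<Phi> \<tau>' \<tau> \<longrightarrow> \<tau>' \<in> pruned M0 c \<or> \<tau>' \<in> sol c)"

end

theory Submission
  imports Defs
begin

text \<open>A formula excluded so far is either an isomorphism class, which is closed under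
  isomorphism, or a generalization \<open>\<gamma> \<sigma>\<close>. If \<open>\<tau>\<close> satisfies \<open>\<gamma> \<sigma>\<close> and \<open>\<tau>'\<close> is isomorphic to
  \<open>\<tau>\<close>, then invertibility yields \<open>\<sigma>'\<close> isomorphic to \<open>\<sigma>\<close> such that \<open>\<tau>'\<close> satisfies \<open>\<gamma> \<sigma>'\<close>, and
  Property 3 says that \<open>\<gamma> \<sigma>'\<close> has been pruned.\<close>

lemma iso_trans:
  assumes "iso M0 \<Phi> \<sigma> \<rho>" "iso M0 \<Phi> \<rho> \<tau>"
  shows "iso M0 \<Phi> \<sigma> \<tau>"
proof -
  let ?Q = "states M0" and ?T = "\<lambda>\<sigma>. transitions (lts_of M0 \<sigma>)"
  obtain f where f: "bij_betw f ?Q ?Q" "\<forall>q \<in> ?Q - isolated_states M0. f q = q"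
    "\<forall>p \<in> ?Q. \<forall>a \<in> labels M0. \<forall>q \<in> ?Q. (p, a, q) \<in> ?T \<sigma> \<longleftrightarrow> (f p, a, f q) \<in> ?T \<rho>"
    using assms(1) unfolding iso_def by blast
  obtain h where h: "bij_betw h ?Q ?Q" "\<forall>q \<in> ?Q - isolated_states M0. h q = q"
    "\<forall>p \<in> ?Q. \<forall>a \<in> labels M0. \<forall>q \<in> ?Q. (p, a, q) \<in> ?T \<rho> \<longleftrightarrow> (h p, a, h q) \<in> ?T \<tau>"
    using assms(2) unfolding iso_def by blast
  \<comment> \<open>The transition condition on \<open>h\<close> is stated for states only; this
    lets it be applied to \<open>f p\<close> and \<open>f q\<close>.\<close>
  have "f q \<in> ?Q" if "q \<in> ?Q" for q
    using f(1) that by (rule bij_betw_apply)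
  then have "\<forall>p \<in> ?Q. \<forall>a \<in> labels M0. \<forall>q \<in> ?Q.
      (p, a, q) \<in> ?T \<sigma> \<longleftrightarrow> ((h \<circ> f) p, a, (h \<circ> f) q) \<in> ?T \<tau>"
    using f(3) h(3) by simp
  moreover have "bij_betw (h \<circ> f) ?Q ?Q"
    using f(1) h(1) by (rule bij_betw_trans)
  moreover have "\<forall>q \<in> ?Q - isolated_states M0. (h \<circ> f) q = q"
    using f(2) h(2) by simp
  ultimately show ?thesis
    using assms unfolding iso_def by blast
qed

lemma models_iso_class:
  assumes "wf_lts M0"
  shows "models M0 (formula_of M0 (iso_class M0 \<Phi> \<sigma>)) = iso_class M0 \<Phi> \<sigma>"
  using assms by (rule models_formula_of) (auto simp: iso_class_def models_def)

lemma models_gen_inverse: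
  assumes "wf_lts M0"
  shows "models M0 (gen_inverse M0 g \<tau>) = {\<sigma> \<in> assignments M0. sat \<tau> (g \<sigma>)}"
  unfolding gen_inverse_def using assms by (rule models_formula_of) auto

text \<open>The models of \<open>gen_inverse M0 g \<tau>\<close> are the assignments whose
  generalization covers \<open>\<tau>\<close>. So \<open>\<sigma>\<close> is one of them, and
  subsumption by \<open>gen_inverse M0 g \<tau>'\<close> supplies an isomorphic
  \<open>\<sigma>'\<close>.\<close>

lemma invertible_transfer:
  assumes wf: "wf_lts M0"
    and inv: "invertible M0 \<Phi> g"
    and iso: "iso M0 \<Phi> \<tau>' \<tau>"
    and \<sigma>: "\<sigma> \<in> models M0 \<Phi>" "sat \<tau> (g \<sigma>)"
  obtains \<sigma>' where "iso M0 \<Phi> \<sigma>' \<sigma>" "sat \<tau>' (g \<sigma>')"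
proof -
  \<comment> \<open>The pair is taken in this order to match \<open>iso\<close>; the second half of
    the equivalence is then the direction wanted.\<close>
  have "equiv_iso M0 \<Phi> (gen_inverse M0 g \<tau>') (gen_inverse M0 g \<tau>)"
    using inv iso by (simp add: invertible_def iso_def)
  then have "subsumes_iso M0 \<Phi> (gen_inverse M0 g \<tau>) (gen_inverse M0 g \<tau>')"
    by (simp add: equiv_iso_def)
  moreover have "\<sigma> \<in> models M0 (gen_inverse M0 g \<tau>)"
    using \<sigma> unfolding models_gen_inverse[OF wf] by (simp add: models_def)
  ultimately obtain \<sigma>' where "\<sigma>' \<in> models M0 (gen_inverse M0 g \<tau>')" "iso M0 \<Phi> \<sigma>' \<sigma>"
    using \<sigma>(1) unfolding subsumes_iso_def models_def by blast
  then show thesis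
    using that by (simp add: models_gen_inverse[OF wf])
qed

text \<open>Each iteration only strengthens \<open>cur\<close>, so every assignment picked satisfies
  \<open>\<Phi>\<close>; the first conjunct carries this through the induction and yields the third.
  The third makes \<open>invertible_transfer\<close> applicable, since subsumption concerns models
  of \<open>\<Phi>\<close>.\<close>

lemma gcg_excluded:
  assumes "(gcg_step M0 \<Phi> \<psi> g)\<^sup>*\<^sup>* (gcg_start \<Phi>) c"
  shows "models M0 (cur c) \<subseteq> models M0 \<Phi>
    \<and> excluded c \<subseteq> range (\<lambda>\<sigma>. formula_of M0 (iso_class M0 \<Phi> \<sigma>)) \<union> g ` generalized c
    \<and> generalized c \<subseteq> models M0 \<Phi>"
  using assms
proof (induction rule: rtranclp_induct)
  case base
  show ?case by (simp add: gcg_start_def)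
next
  case (step c d)
  from step.hyps(2) step.IH show ?case
    by cases (auto simp: models_def)
qed

theorem theorem3:
  fixes M0 :: "('q, 's) lts"
    and \<Phi> :: "('q, 's) var form"
    and \<psi> :: "('q, 's) spec"
    and \<gamma> :: "('q, 's) gen"
  assumes "wf_lts M0"
    and "\<Phi> \<in> formulas M0"
    and "\<And>\<sigma>. \<sigma> \<in> models M0 \<Phi> \<Longrightarrow> \<forall>v \<in> transitions M0. sat \<sigma> (FAtom v)"
    and "iso_invariant M0 \<Phi> \<psi>"
    and "generalizer M0 \<gamma>"
    and "proper M0 \<Phi> \<psi> \<gamma>"
    and "invertible M0 \<Phi> \<gamma>"
    and "gcg_maintains M0 \<Phi> \<psi> \<gamma> (property3 M0 \<Phi> \<gamma>)"
  shows "gcg_maintains M0 \<Phi> \<psi> \<gamma> (property4 M0 \<Phi>)"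
proof -
  have "\<tau>' \<in> pruned M0 c"
    if reach: "(gcg_step M0 \<Phi> \<psi> \<gamma>)\<^sup>*\<^sup>* (gcg_start \<Phi>) c"
      and \<tau>: "\<tau> \<in> pruned M0 c"
      and iso: "iso M0 \<Phi> \<tau>' \<tau>"
    for c \<tau> \<tau>'
  proof -
    obtain \<phi> where \<phi>: "\<phi> \<in> excluded c" "\<tau> \<in> models M0 \<phi>"
      using \<tau> by (auto simp: pruned_def)
    then consider (iso_class) \<sigma> where "\<phi> = formula_of M0 (iso_class M0 \<Phi> \<sigma>)"
      | (generalized) \<sigma> where "\<phi> = \<gamma> \<sigma>" "\<sigma> \<in> generalized c" "\<sigma> \<in> models M0 \<Phi>"
      using gcg_excluded[OF reach] by blast
    then show ?thesis
    proof cases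
      case iso_class
      then have "iso M0 \<Phi> \<tau> \<sigma>"
        using \<phi>(2) models_iso_class[OF assms(1)] unfolding iso_class_def by blast
      \<comment> \<open>Membership in the class means being isomorphic to its representative
        \<open>\<sigma>\<close>, so the chain is extended on the left.\<close>
      with iso have "iso M0 \<Phi> \<tau>' \<sigma>"
        by (rule iso_trans)
      then have "\<tau>' \<in> models M0 \<phi>"
        unfolding iso_class models_iso_class[OF assms(1)] by (simp add: iso_class_def iso_def)
      with \<phi>(1) show ?thesis
        by (auto simp: pruned_def)
    next
      case generalized
      have "sat \<tau> (\<gamma> \<sigma>)"
        using \<phi>(2) generalized(1) by (simp add: models_def)
      then obtain \<sigma>' where \<sigma>': "iso M0 \<Phi> \<sigma>' \<sigma>" "sat \<tau>' (\<gamma> \<sigma>')"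
        using invertible_transfer[OF assms(1,7) iso generalized(3)] by blast
      \<comment> \<open>The algorithm may never have picked \<open>\<sigma>'\<close> itself;
        Property 3 at \<open>c\<close> covers it through \<open>\<sigma>\<close>.\<close>
      have "property3 M0 \<Phi> \<gamma> c"
        using assms(8) reach by (simp add: gcg_maintains_def)
      then have "models M0 (\<gamma> \<sigma>') \<subseteq> pruned M0 c"
        using generalized(2) \<sigma>'(1) by (simp add: property3_def)
      moreover have "\<tau>' \<in> models M0 (\<gamma> \<sigma>')"
        using iso \<sigma>'(2) by (simp add: iso_def models_def)
      ultimately show ?thesis
        by blast
    qed
  qed
  then show ?thesis
    unfolding gcg_maintains_def property4_def by blast
qed

end
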